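(* There is no online algorithm for the coloured bin packing problem that is an $(\alpha,\beta)$-approximation algorithm with $\alpha$ and $\beta$ constants.
   Context: Coloured bin packing: an instance $I$ is a finite set of items, each item $e$ having a size $s(e)\in(0,1]$ and a colour $c(e)\in\{1,\dots,m\}$; items are packed into unit-capacity bins. $I_c$ is the set of items of colour $c$; $\mathrm{OPT}(I)$ and $\mathrm{OPT}(I_c)$ are the minimum numbers of bins needed to pack $I$ and $I_c$ (computed offline, with full knowledge of $I$). For a packing $P$, $P(I)$ is the number of bins used and $P_c(I)$ the number of bins containing at least one item of colour $c$. An algorithm is an $(\alpha,\beta)$-approximation algorithm if on every instance its packing satisfies $P(I)\le\alpha\,\mathrm{OPT}(I)+O(1)$ and $P_c(I)\le\beta\,\mathrm{OPT}(I_c)+O(1)$ for every colour $c$, with additive constants independent of the instance. In the online setting, items arrive one at a time and each must be irrevocably assigned to a bin upon arrival, without knowledge of future items. *)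

theory Defs
  imports Complex_Main
begin

datatype item = Item (item_size: real) (item_colour: nat)

text \<open>An instance is the list of its items in order of arrival; an item is identified by its
  position in the list, so distinct items may agree in size and colour. The number \<open>m\<close> of
  colours varies with the instance.\<close>

definition instances :: "nat \<Rightarrow> item list set" where
  "instances m = {I. \<forall>e\<in>set I. 0 < item_size e \<and> item_size e \<le> 1 \<and> item_colour e \<in> {1..m}}"

definition all_items :: "item list \<Rightarrow> nat set" where
  "all_items I = {..<length I}"

definition items_of_colour :: "nat \<Rightarrow> item list \<Rightarrow> nat set" where
  "items_of_colour c I = {i. i < length I \<and> item_colour (I ! i) = c}"

text \<open>A packing of a set \<open>J\<close> of items of \<open>I\<close> maps each of them to the (index of the) bin
  containing it; its values outside \<open>J\<close> are irrelevant.\<close>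

definition is_packing :: "item list \<Rightarrow> nat set \<Rightarrow> (nat \<Rightarrow> nat) \<Rightarrow> bool" where
  "is_packing I J p \<longleftrightarrow> (\<forall>b. (\<Sum>i | i \<in> J \<and> p i = b. item_size (I ! i)) \<le> 1)"

definition num_bins :: "(nat \<Rightarrow> nat) \<Rightarrow> nat set \<Rightarrow> nat" where
  "num_bins p J = card (p ` J)"

definition opt :: "item list \<Rightarrow> nat set \<Rightarrow> nat" where
  "opt I J = (LEAST k. \<exists>p. is_packing I J p \<and> num_bins p J = k)"

lemma opt_attained:
  assumes "I \<in> instances m" and "J \<subseteq> all_items I"
  shows "\<exists>p. is_packing I J p \<and> num_bins p J = opt I J"
proof -
  have "(\<Sum>i | i \<in> J \<and> id i = b. item_size (I ! i)) \<le> 1" for b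
  proof (cases "b \<in> J")
    case True
    then have "{i. i \<in> J \<and> id i = b} = {b}" by auto
    moreover have "I ! b \<in> set I" using True assms(2) by (auto simp: all_items_def)
    ultimately show ?thesis using assms(1) by (simp add: instances_def)
  next
    case False
    then have "{i. i \<in> J \<and> id i = b} = {}" by auto
    then show ?thesis by (simp only: sum.empty)
  qed
  then have "is_packing I J id" unfolding is_packing_def by blast
  then have "\<exists>k p. is_packing I J p \<and> num_bins p J = k" by auto
  then show ?thesis unfolding opt_def by (rule LeastI_ex)
qed

text \<open>A (deterministic) algorithm returns an assignment of items to bins for each number of
  colours and each instance.\<close>

type_synonym algorithm = "nat \<Rightarrow> item list \<Rightarrow> nat \<Rightarrow> nat"

text \<open>The bin of an arriving item is a function of the number of colours, the items that arrived
  before it, and the item itself. The earlier bin assignments need not be passed on, since they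
  are determined by the same data.\<close>

definition online_algorithm :: "algorithm \<Rightarrow> bool" where
  "online_algorithm alg \<longleftrightarrow>
     (\<exists>decide :: nat \<Rightarrow> item list \<Rightarrow> item \<Rightarrow> nat.
        \<forall>m. \<forall>I\<in>instances m. \<forall>i<length I. alg m I i = decide m (take i I) (I ! i))"

text \<open>The additive constants are chosen before the number of colours, the instance and the colour.\<close>

definition approximation_algorithm :: "real \<Rightarrow> real \<Rightarrow> algorithm \<Rightarrow> bool" where
  "approximation_algorithm \<alpha> \<beta> alg \<longleftrightarrow>
     (\<forall>m. \<forall>I\<in>instances m. is_packing I (all_items I) (alg m I)) \<and>
     (\<exists>K. \<forall>m. \<forall>I\<in>instances m.
        real (num_bins (alg m I) (all_items I)) \<le> \<alpha> * real (opt I (all_items I)) + K) \<and>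
     (\<exists>K. \<forall>m. \<forall>I\<in>instances m. \<forall>c\<in>{1..m}.
        real (num_bins (alg m I) (items_of_colour c I))
          \<le> \<beta> * real (opt I (items_of_colour c I)) + K)"

end

theory Submission
  imports Defs
begin

text \<open>All items have the same tiny size, so that the total and every colour class have small
  optimum. The adversary maintains a set \<open>S\<close> of colours and a set \<open>F\<close> of bins such that every
  colour of \<open>S\<close> already occurs in every bin of \<open>F\<close>. It then sends items of each colour of \<open>S\<close> in
  turn, until one of them leaves \<open>F\<close> or a quota is exhausted. Since \<open>F\<close> has bounded capacity, only
  boundedly many colours exhaust their quota, and the total volume sent is bounded; hence so is the
  number of bins open, and by pigeonhole a constant fraction of the remaining colours share a bin
  outside \<open>F\<close>. With enough colours this can be iterated until some colour with optimum 1 occurs in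
  more bins than allowed.\<close>

section \<open>Words of colours and the bins they are assigned to\<close>

text \<open>A word lists the colours of equally sized items; \<open>d w c\<close> is the bin of an item of colour \<open>c\<close>
  arriving after \<open>w\<close>.\<close>

definition bin_of :: "(nat list \<Rightarrow> nat \<Rightarrow> nat) \<Rightarrow> nat list \<Rightarrow> nat \<Rightarrow> nat" where
  "bin_of d w i = d (take i w) (w ! i)"

definition bins :: "(nat list \<Rightarrow> nat \<Rightarrow> nat) \<Rightarrow> nat list \<Rightarrow> nat set" where
  "bins d w = bin_of d w ` {..<length w}"

definition colour_bins :: "(nat list \<Rightarrow> nat \<Rightarrow> nat) \<Rightarrow> nat list \<Rightarrow> nat \<Rightarrow> nat set" where
  "colour_bins d w c = bin_of d w ` {i. i < length w \<and> w ! i = c}"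

text \<open>Since all items have equal size, the volume packed into \<open>F\<close> is measured by
  counting items.\<close>

definition load :: "(nat list \<Rightarrow> nat \<Rightarrow> nat) \<Rightarrow> nat list \<Rightarrow> nat set \<Rightarrow> nat" where
  "load d w F = card {i. i < length w \<and> bin_of d w i \<in> F}"

lemma bin_of_append: "i < length w \<Longrightarrow> bin_of d (w @ v) i = bin_of d w i"
  by (simp add: bin_of_def nth_append)

lemma bin_of_snoc: "bin_of d (w @ [c]) (length w) = d w c"
  by (simp add: bin_of_def)

lemma colour_bins_subset_bins: "colour_bins d w c \<subseteq> bins d w"
  by (auto simp: colour_bins_def bins_def)

lemma finite_bins [simp]: "finite (bins d w)"
  by (simp add: bins_def)

lemma colour_bins_append: "colour_bins d w c \<subseteq> colour_bins d (w @ v) c"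
proof
  fix b assume "b \<in> colour_bins d w c"
  then obtain i where i: "i < length w" "w ! i = c" "b = bin_of d w i"
    by (auto simp: colour_bins_def)
  show "b \<in> colour_bins d (w @ v) c" unfolding colour_bins_def
  proof (rule image_eqI)
    show "b = bin_of d (w @ v) i" using i by (simp add: bin_of_append)
    show "i \<in> {i. i < length (w @ v) \<and> (w @ v) ! i = c}" using i by (simp add: nth_append)
  qed
qed

lemma colour_bins_snoc: "d w c \<in> colour_bins d (w @ [c]) c"
  unfolding colour_bins_def
  by (rule image_eqI[of _ _ "length w"]) (simp_all add: bin_of_snoc)

lemma load_snoc: "load d (w @ [c]) F = load d w F + (if d w c \<in> F then 1 else 0)"
proof -
  have "{i. i < length (w @ [c]) \<and> bin_of d (w @ [c]) i \<in> F} =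
      {i. i < length w \<and> bin_of d w i \<in> F} \<union> (if d w c \<in> F then {length w} else {})"
    by (auto simp: less_Suc_eq bin_of_append bin_of_snoc)
  then show ?thesis by (auto simp: load_def)
qed

lemma load_append: "load d w F \<le> load d (w @ v) F"
  unfolding load_def by (rule card_mono) (auto simp: bin_of_append)

lemma load_le:
  assumes "finite F" and "\<And>b. card {i. i < length w \<and> bin_of d w i = b} \<le> D"
  shows "load d w F \<le> card F * D"
proof -
  have "{i. i < length w \<and> bin_of d w i \<in> F} = (\<Union>b\<in>F. {i. i < length w \<and> bin_of d w i = b})"
    by auto
  then have "load d w F \<le> (\<Sum>b\<in>F. card {i. i < length w \<and> bin_of d w i = b})"
    unfolding load_def using card_UN_le[OF assms(1)] by metis
  also have "\<dots> \<le> (\<Sum>b\<in>F. D)" by (rule sum_mono) (rule assms(2))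
  finally show ?thesis by simp
qed

lemma count_list_replicate: "count_list (replicate t c) x = (if x = c then t else 0)"
  by (induction t) auto

text \<open>Pigeonhole principle. The strict inequality also excludes an empty \<open>Y\<close>,
  which has no fibre to offer.\<close>

lemma large_fibre:
  assumes "finite A" "finite Y" "g ` A \<subseteq> Y" "card Y * N < card A"
  shows "\<exists>y\<in>Y. N \<le> card {x \<in> A. g x = y}"
proof (rule ccontr)
  assume "\<not> ?thesis"
  then have small: "\<And>y. y \<in> Y \<Longrightarrow> card {x \<in> A. g x = y} \<le> N" by (auto simp: not_le)
  have "A = (\<Union>y\<in>Y. {x \<in> A. g x = y})" using assms(3) by auto
  then have "card A \<le> (\<Sum>y\<in>Y. card {x \<in> A. g x = y})"
    using card_UN_le[OF assms(2)] by metis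
  also have "\<dots> \<le> (\<Sum>y\<in>Y. N)" by (rule sum_mono) (rule small)
  finally show False using assms(4) by simp
qed

section \<open>The adversary\<close>

text \<open>Copies of \<open>c\<close> are sent one by one until \<open>c\<close> occupies a bin
  outside \<open>F\<close> or \<open>E\<close> copies have landed in \<open>F\<close>. Only the last
  copy can miss \<open>F\<close>, hence the slack of 1.\<close>

lemma flood_colour:
  "\<exists>t\<le>E. t + load d w F \<le> load d (w @ replicate t c) F + 1 \<and>
     (\<not> colour_bins d (w @ replicate t c) c \<subseteq> F \<or>
      E + load d w F \<le> load d (w @ replicate t c) F)"
proof (induction E)
  case 0
  show ?case by simp
next
  case (Suc E)
  then obtain t where t: "t \<le> E" "t + load d w F \<le> load d (w @ replicate t c) F + 1"
    and alt: "\<not> colour_bins d (w @ replicate t c) c \<subseteq> F \<or>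
      E + load d w F \<le> load d (w @ replicate t c) F" by blast
  show ?case
  proof (cases "colour_bins d (w @ replicate t c) c \<subseteq> F")
    case False
    then show ?thesis using t by (intro exI[of _ t]) auto
  next
    case True
    let ?w = "w @ replicate t c"
    \<comment> \<open>Together with \<open>t\<close> \<le> \<open>E\<close> this says that no copy
      has missed \<open>F\<close> so far, so the slack of 1 is still available for the next
      copy.\<close>
    have E: "E + load d w F \<le> load d ?w F" using True alt by blast
    have eq: "w @ replicate (Suc t) c = ?w @ [c]" by (simp add: replicate_append_same)
    have "\<not> colour_bins d (?w @ [c]) c \<subseteq> F" if "d ?w c \<notin> F"
      using that colour_bins_snoc by blast
    then show ?thesis unfolding eq[symmetric] using t E eq load_snoc[of d ?w c F]
      by (intro exI[of _ "Suc t"]) (auto simp del: replicate_Suc split: if_splits)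
  qed
qed

text \<open>\<open>X\<close> collects the colours that exhaust their quota \<open>E\<close> without leaving \<open>F\<close>.\<close>

lemma flood_colours:
  assumes "finite T"
  shows "\<exists>v X. set v \<subseteq> T \<and> X \<subseteq> T \<and> (\<forall>c. count_list v c \<le> E) \<and>
     length v + load d w F \<le> load d (w @ v) F + card T \<and>
     card X * E + load d w F \<le> load d (w @ v) F \<and>
     (\<forall>c\<in>T - X. \<not> colour_bins d (w @ v) c \<subseteq> F)"
  using assms
proof (induction T)
  case empty
  show ?case by (intro exI[of _ "[]"] exI[of _ "{}"]) simp
next
  case (insert c T)
  then obtain v X where v: "set v \<subseteq> T" "X \<subseteq> T" "\<And>c. count_list v c \<le> E"
    "length v + load d w F \<le> load d (w @ v) F + card T"
    "card X * E + load d w F \<le> load d (w @ v) F"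
    "\<And>c. c \<in> T - X \<Longrightarrow> \<not> colour_bins d (w @ v) c \<subseteq> F" by blast
  obtain t where t: "t \<le> E"
    "t + load d (w @ v) F \<le> load d ((w @ v) @ replicate t c) F + 1"
    and alt: "\<not> colour_bins d ((w @ v) @ replicate t c) c \<subseteq> F \<or>
      E + load d (w @ v) F \<le> load d ((w @ v) @ replicate t c) F"
    using flood_colour[of E d "w @ v" F c] by blast
  let ?v = "v @ replicate t c"
  have c: "c \<notin> set v" "c \<notin> X" "finite X"
    using v(1,2) insert.hyps finite_subset by blast+
  have count: "count_list ?v x \<le> E" for x
    using v(3)[of x] t(1) c(1) by (simp add: count_list_replicate)
  have left: "\<not> colour_bins d (w @ ?v) x \<subseteq> F" if "x \<in> T - X" for x
    using v(6)[OF that] colour_bins_append[of d "w @ v" x "replicate t c"] by auto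
  have mono: "load d (w @ v) F \<le> load d (w @ ?v) F"
    using load_append[of d "w @ v" F "replicate t c"] by simp
  show ?case
  proof (cases "colour_bins d (w @ ?v) c \<subseteq> F")
    case False
    then show ?thesis using v t c left insert.hyps count mono
      by (intro exI[of _ ?v] exI[of _ X]) auto
  next
    case True
    \<comment> \<open>Here \<open>c\<close> never left \<open>F\<close>, so \<open>alt\<close>
      supplies \<open>E\<close> further items in \<open>F\<close>, which pay for adding
      \<open>c\<close> to \<open>X\<close>.\<close>
    then show ?thesis using v t c left insert.hyps count alt
      by (intro exI[of _ ?v] exI[of _ "insert c X"]) auto
  qed
qed


text \<open>A bin holds \<open>k * Q ^ k\<close> items. Each of \<open>k\<close> rounds sends at
  most \<open>Q ^ k\<close> items per colour, so every colour that survives all rounds would fit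
  into one bin. \<open>Q\<close> is the factor by which a round may shrink the set of surviving
  colours.\<close>

lemma adversary_wins:
  fixes d :: "nat list \<Rightarrow> nat \<Rightarrow> nat" and a K k :: nat
  defines "Q \<equiv> k * k + (a * (k * k + 1) + K) + 1"
  assumes U: "finite U" "card U = Q ^ k" and k: "0 < k"
    and capacity: "\<And>w b. set w \<subseteq> U \<Longrightarrow>
      card {i. i < length w \<and> bin_of d w i = b} \<le> k * Q ^ k"
    and total: "\<And>w. set w \<subseteq> U \<Longrightarrow>
      card (bins d w) \<le> a * (length w div (k * Q ^ k) + 1) + K"
  shows "\<exists>w. \<exists>c\<in>U. set w \<subseteq> U \<and> count_list w c \<le> k * Q ^ k \<and> k \<le> card (colour_bins d w c)"
proof -
  define E where "E = Q ^ k"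
  have E: "0 < E" by (simp add: E_def Q_def)
  \<comment> \<open>Invariant after \<open>j\<close> rounds: the surviving colours \<open>S\<close>
    share the \<open>j\<close> bins \<open>F\<close>. With bin capacity \<open>k * E\<close>, each
    round adds at most \<open>k\<close> bins' worth of items.\<close>
  have "\<exists>w S F. set w \<subseteq> U \<and> S \<subseteq> U \<and> finite F \<and> card F = j \<and> Q ^ (k - j) \<le> card S \<and>
      length w \<le> j * k * (k * E) \<and>
      (\<forall>c\<in>S. F \<subseteq> colour_bins d w c \<and> count_list w c \<le> j * E)" if "j \<le> k" for j
    using that
  proof (induction j)
    case 0
    show ?case using U by (intro exI[of _ "[]"] exI[of _ U] exI[of _ "{}"]) simp
  next
    case (Suc j)
    then have j: "j < k" by simp
    from Suc obtain w S F where w: "set w \<subseteq> U" "length w \<le> j * k * (k * E)"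
      and S: "S \<subseteq> U" "Q ^ (k - j) \<le> card S" and F: "finite F" "card F = j"
      and SF: "\<And>c. c \<in> S \<Longrightarrow> F \<subseteq> colour_bins d w c"
        "\<And>c. c \<in> S \<Longrightarrow> count_list w c \<le> j * E" by auto
    have finS: "finite S" using S(1) U(1) by (rule finite_subset)
    obtain v X where v: "set v \<subseteq> S" "X \<subseteq> S" "\<And>c. count_list v c \<le> E"
      "length v + load d w F \<le> load d (w @ v) F + card S"
      "card X * E + load d w F \<le> load d (w @ v) F"
      "\<And>c. c \<in> S - X \<Longrightarrow> \<not> colour_bins d (w @ v) c \<subseteq> F"
      using flood_colours[OF finS, of E d w F] by blast
    let ?w = "w @ v"
    have wU: "set ?w \<subseteq> U" using w(1) v(1) S(1) by auto
    have load: "load d ?w F \<le> j * (k * E)"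
      using load_le[OF F(1), of ?w d "k * E"] capacity[OF wU] F(2) by (simp add: E_def)
    \<comment> \<open>Each exhausted colour put \<open>E\<close> items into the \<open>j\<close>
      bins of \<open>F\<close>, which have room for \<open>k * E\<close> items each.\<close>
    have "card X * E \<le> (j * k) * E" using v(5) load unfolding mult.assoc by linarith
    then have "card X \<le> j * k" by (rule mult_right_le_imp_le[OF _ E])
    also have "\<dots> \<le> k * k" using j by simp
    finally have X: "card X \<le> k * k" .
    \<comment> \<open>At most one item per colour misses \<open>F\<close>. As \<open>E\<close>
      equals the number of all colours, these strays amount to at most one more bin's worth.\<close>
    have "card S \<le> E" using card_mono[OF U(1) S(1)] U(2) by (simp add: E_def)
    also have "\<dots> \<le> k * E" using k by simp
    finally have "length v \<le> (j + 1) * (k * E)" using v(4) load by simp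
    also have "\<dots> \<le> k * (k * E)" using j by (intro mult_right_mono) auto
    finally have len: "length ?w \<le> Suc j * k * (k * E)"
      using w(2) by (simp add: algebra_simps)
    have "length ?w div (k * E) \<le> (Suc j * k * (k * E)) div (k * E)"
      using len by (rule div_le_mono)
    also have "\<dots> = Suc j * k" using E k by simp
    also have "\<dots> \<le> k * k" using j by (intro mult_right_mono) auto
    finally have "length ?w div (k * E) \<le> k * k" .
    then have "a * (length ?w div (k * E) + 1) + K \<le> a * (k * k + 1) + K"
      by (intro add_mono mult_left_mono) auto
    then have bins: "card (bins d ?w) \<le> a * (k * k + 1) + K"
      using total[OF wU] unfolding E_def[symmetric] by (rule order_trans[rotated])
    have "\<forall>c\<in>S - X. \<exists>b. b \<in> colour_bins d ?w c \<and> b \<notin> F" using v(6) by blast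
    then obtain g where g: "\<And>c. c \<in> S - X \<Longrightarrow> g c \<in> colour_bins d ?w c \<and> g c \<notin> F"
      by metis
    define R where "R = Q ^ (k - Suc j)"
    have R: "1 \<le> R" by (simp add: R_def Q_def)
    \<comment> \<open>The summands of \<open>Q\<close> cover, in this order, the exhausted colours,
      the open bins with \<open>R\<close> colours each, and the strictness required by the
      pigeonhole principle.\<close>
    have "card (bins d ?w) * R + k * k < Q * R"
    proof -
      have "card (bins d ?w) * R \<le> (a * (k * k + 1) + K) * R" using bins by simp
      moreover have "k * k * 1 \<le> k * k * R" using R by (intro mult_left_mono) auto
      moreover have "Q * R = k * k * R + (a * (k * k + 1) + K) * R + R"
        by (simp add: Q_def algebra_simps)
      ultimately show ?thesis using R by linarith
    qed
    also have "Q * R = Q ^ (k - j)" using j by (simp add: R_def Suc_diff_Suc flip: power_Suc)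
    also have "\<dots> \<le> card S" by (rule S(2))
    also have "\<dots> \<le> card (S - X) + k * k"
      using card_Diff_subset[OF finite_subset[OF v(2) finS] v(2)] X by simp
    finally have "card (bins d ?w) * R < card (S - X)" by simp
    moreover have "g ` (S - X) \<subseteq> bins d ?w" using g colour_bins_subset_bins by blast
    ultimately obtain b where b: "R \<le> card {c \<in> S - X. g c = b}"
      using large_fibre[of "S - X" "bins d ?w" g R] finS by auto
    let ?S = "{c \<in> S - X. g c = b}"
    \<comment> \<open>Nonemptiness of the fibre makes \<open>b\<close> a value of \<open>g\<close>,
      hence a bin outside \<open>F\<close>, so that \<open>F\<close> really grows.\<close>
    have "card ?S \<noteq> 0" using b R by linarith
    then have "?S \<noteq> {}" by (metis card.empty)
    then have bF: "b \<notin> F" using g by auto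
    have "insert b F \<subseteq> colour_bins d ?w c \<and> count_list ?w c \<le> Suc j * E" if "c \<in> ?S" for c
      using that g[of c] SF[of c] colour_bins_append[of d w c v] v(3)[of c] by auto
    then show ?case using wU S(1) F bF b len
      by (intro exI[of _ ?w] exI[of _ ?S] exI[of _ "insert b F"]) (auto simp: R_def)
  qed
  \<comment> \<open>After \<open>k\<close> rounds the bound \<open>Q ^ (k - k)\<close> still leaves
    one colour, and it occupies all \<open>k\<close> bins of \<open>F\<close>.\<close>
  from this[of k] obtain w S F where w: "set w \<subseteq> U" "S \<subseteq> U" "card F = k" "1 \<le> card S"
    "\<And>c. c \<in> S \<Longrightarrow> F \<subseteq> colour_bins d w c \<and> count_list w c \<le> k * E" by auto
  then obtain c where "c \<in> S" by (metis card.empty equals0I not_one_le_zero)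
  moreover from \<open>c \<in> S\<close> have "k \<le> card (colour_bins d w c)"
    using w(3,5) card_mono[of "colour_bins d w c" F] by (auto simp: colour_bins_def)
  moreover have "c \<in> U" "count_list w c \<le> k * Q ^ k"
    using w(2) w(5)[of c] \<open>c \<in> S\<close> by (auto simp: E_def)
  ultimately show ?thesis using w(1) by blast
qed

section \<open>Translation to coloured bin packing\<close>

text \<open>With the common size \<open>1 / real D\<close>, for positive \<open>D\<close>, the
  capacity constraint becomes a count: at most \<open>D\<close> items per bin.\<close>

definition items_of :: "nat \<Rightarrow> nat list \<Rightarrow> item list" where
  "items_of D w = map (Item (1 / real D)) w"

lemma items_of_nth:
  assumes "i < length w"
  shows "item_size (items_of D w ! i) = 1 / real D" "item_colour (items_of D w ! i) = w ! i"
  using assms by (simp_all add: items_of_def)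

lemma items_of_in_instances:
  "0 < D \<Longrightarrow> set w \<subseteq> {1..m} \<Longrightarrow> items_of D w \<in> instances m"
  by (auto simp: instances_def items_of_def)

lemma is_packing_items_of_iff:
  assumes "0 < D" and "J \<subseteq> {..<length w}"
  shows "is_packing (items_of D w) J p \<longleftrightarrow> (\<forall>b. card {i \<in> J. p i = b} \<le> D)"
proof -
  have "(\<Sum>i | i \<in> J \<and> p i = b. item_size (items_of D w ! i)) = card {i \<in> J. p i = b} / D" for b
  proof -
    have "(\<Sum>i | i \<in> J \<and> p i = b. item_size (items_of D w ! i)) = (\<Sum>i | i \<in> J \<and> p i = b. 1 / real D)"
      using assms(2) by (intro sum.cong) (auto simp: items_of_nth)
    then show ?thesis by simp
  qed
  then show ?thesis using assms(1) by (simp add: is_packing_def)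
qed

lemma opt_le: "is_packing I J p \<Longrightarrow> opt I J \<le> num_bins p J"
  unfolding opt_def by (rule Least_le) blast

text \<open>Bins are filled consecutively, \<open>D\<close> items each. The bin indices run from 0
  to at most \<open>length w div D\<close>, hence the 1.\<close>

lemma opt_all_items_of_le:
  assumes "0 < D"
  shows "opt (items_of D w) (all_items (items_of D w)) \<le> length w div D + 1"
proof -
  let ?J = "all_items (items_of D w)" and ?p = "\<lambda>i. i div D"
  have J: "?J = {..<length w}" by (simp add: all_items_def items_of_def)
  have "card {i \<in> {..<length w}. i div D = b} \<le> D" for b
  proof -
    have "{i \<in> {..<length w}. i div D = b} \<subseteq> {b * D..<b * D + D}"
    proof safe
      fix x assume "b = x div D"
      show "x \<in> {x div D * D..<x div D * D + D}"
        using dividend_less_div_times[OF assms, of x] by (simp add: add.commute)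
    qed
    then have "card {i \<in> {..<length w}. i div D = b} \<le> card {b * D..<b * D + D}"
      by (intro card_mono) auto
    then show ?thesis by simp
  qed
  then have "opt (items_of D w) ?J \<le> num_bins ?p ?J"
    unfolding J using assms by (intro opt_le) (simp add: is_packing_items_of_iff)
  also have "num_bins ?p ?J \<le> card {..length w div D}"
    unfolding num_bins_def J by (rule card_mono) (auto intro: div_le_mono)
  finally show ?thesis by simp
qed

lemma items_of_colour_items_of:
  "items_of_colour c (items_of D w) = {i. i < length w \<and> w ! i = c}"
  by (auto simp: items_of_colour_def items_of_nth) (simp_all add: items_of_def)

text \<open>The whole colour class goes into bin 0. The optimum is 0 if the colour does not
  occur.\<close>

lemma opt_items_of_colour_le:
  assumes "0 < D" and "count_list w c \<le> D"
  shows "opt (items_of D w) (items_of_colour c (items_of D w)) \<le> 1"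
proof -
  let ?J = "{i. i < length w \<and> w ! i = c}"
  have "card ?J = count_list w c"
    by (simp add: count_list_eq_length_filter length_filter_conv_card eq_commute)
  then have "card {i \<in> ?J. 0 = b} \<le> D" for b :: nat
    using assms(2) by (cases "b = 0") auto
  then have "is_packing (items_of D w) ?J (\<lambda>_. 0)"
    using assms(1) by (subst is_packing_items_of_iff) auto
  then have "opt (items_of D w) ?J \<le> num_bins (\<lambda>_. 0) ?J" by (rule opt_le)
  also have "\<dots> \<le> card {0::nat}" unfolding num_bins_def by (rule card_mono) auto
  finally show ?thesis by (simp add: items_of_colour_items_of)
qed

theorem theorem4:
  "\<not> (\<exists>(\<alpha>::real) (\<beta>::real) alg. online_algorithm alg \<and> approximation_algorithm \<alpha> \<beta> alg)"
proof
  assume "\<exists>(\<alpha>::real) (\<beta>::real) alg. online_algorithm alg \<and> approximation_algorithm \<alpha> \<beta> alg"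
  then obtain \<alpha> \<beta> :: real and alg where online: "online_algorithm alg"
    and approx: "approximation_algorithm \<alpha> \<beta> alg" by blast
  obtain decide where decide:
    "\<And>m I i. I \<in> instances m \<Longrightarrow> i < length I \<Longrightarrow> alg m I i = decide m (take i I) (I ! i)"
    using online unfolding online_algorithm_def by blast
  obtain K\<^sub>1 K\<^sub>2 where
    packing: "\<And>m I. I \<in> instances m \<Longrightarrow> is_packing I (all_items I) (alg m I)" and
    total: "\<And>m I. I \<in> instances m \<Longrightarrow>
      real (num_bins (alg m I) (all_items I)) \<le> \<alpha> * real (opt I (all_items I)) + K\<^sub>1" and
    colour: "\<And>m I c. I \<in> instances m \<Longrightarrow> c \<in> {1..m} \<Longrightarrow>
      real (num_bins (alg m I) (items_of_colour c I))
        \<le> \<beta> * real (opt I (items_of_colour c I)) + K\<^sub>2"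
    using approx unfolding approximation_algorithm_def by metis
  obtain a :: nat where a: "\<alpha> \<le> real a" using real_arch_simple by blast
  obtain K :: nat where K: "K\<^sub>1 \<le> real K" using real_arch_simple by blast
  \<comment> \<open>A colour with optimum 0 or 1 may occupy at most this many bins; the absolute
    values cover both optima and negative constants.\<close>
  obtain k :: nat where k: "\<bar>\<beta>\<bar> + \<bar>K\<^sub>2\<bar> < real k" using reals_Archimedean2 by blast
  then have k_pos: "0 < k" by (cases k) auto
  define Q where "Q = k * k + (a * (k * k + 1) + K) + 1"
  \<comment> \<open>The number of colours may depend on \<open>a\<close>, \<open>K\<close> and
    \<open>k\<close> because the additive constants are fixed before it.\<close>
  define m where "m = Q ^ k"
  define D where "D = k * m"
  have D: "0 < D" using k_pos by (simp add: D_def m_def Q_def)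
  \<comment> \<open>Being online, the algorithm acts on words through this one decision function,
    which lets the adversary extend a word without altering earlier assignments.\<close>
  define d where "d = (\<lambda>w c. decide m (items_of D w) (Item (1 / real D) c))"
  have alg: "alg m (items_of D w) i = bin_of d w i" if "set w \<subseteq> {1..m}" "i < length w" for w i
    using decide[OF items_of_in_instances[OF D that(1)], of i] that(2)
    by (simp add: d_def bin_of_def items_of_def take_map)
  have all: "all_items (items_of D w) = {..<length w}" for w
    by (simp add: all_items_def items_of_def)
  have "\<exists>w. \<exists>c\<in>{1..m}. set w \<subseteq> {1..m} \<and> count_list w c \<le> k * Q ^ k \<and>
      k \<le> card (colour_bins d w c)"
    unfolding Q_def
  proof (rule adversary_wins, unfold Q_def[symmetric])
    show "finite {1..m}" "card {1..m} = Q ^ k" by (simp_all add: m_def)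
    show "0 < k" by (rule k_pos)
  next
    fix w :: "nat list" and b assume w: "set w \<subseteq> {1..m}"
    have "card {i \<in> {..<length w}. alg m (items_of D w) i = b} \<le> D"
      using packing[OF items_of_in_instances[OF D w]] is_packing_items_of_iff[OF D order_refl]
      by (simp add: all)
    moreover have "{i \<in> {..<length w}. alg m (items_of D w) i = b} =
        {i. i < length w \<and> bin_of d w i = b}" using alg[OF w] by auto
    ultimately show "card {i. i < length w \<and> bin_of d w i = b} \<le> k * Q ^ k"
      by (simp add: D_def m_def)
  next
    fix w assume w: "set w \<subseteq> {1..m}"
    let ?o = "opt (items_of D w) (all_items (items_of D w))"
    have "alg m (items_of D w) ` {..<length w} = bins d w"
      unfolding bins_def using alg[OF w] by (intro image_cong) auto
    then have "real (card (bins d w)) \<le> \<alpha> * real ?o + K\<^sub>1"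
      using total[OF items_of_in_instances[OF D w]] by (simp add: num_bins_def all)
    also have "\<dots> \<le> real a * real ?o + real K" using a K by (intro add_mono mult_right_mono) auto
    also have "\<dots> \<le> real a * real (length w div D + 1) + real K"
      using opt_all_items_of_le[OF D, of w]
      by (intro add_right_mono mult_left_mono) (simp_all only: of_nat_le_iff of_nat_0_le_iff)
    also have "\<dots> = real (a * (length w div D + 1) + K)" by (simp only: of_nat_add of_nat_mult)
    finally show "card (bins d w) \<le> a * (length w div (k * Q ^ k) + 1) + K"
      unfolding D_def m_def by (simp only: of_nat_le_iff)
  qed
  then obtain w c where w: "c \<in> {1..m}" "set w \<subseteq> {1..m}" "count_list w c \<le> D"
    "k \<le> card (colour_bins d w c)" by (auto simp: D_def m_def)
  let ?o = "opt (items_of D w) (items_of_colour c (items_of D w))"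
  have "alg m (items_of D w) ` {i. i < length w \<and> w ! i = c} = colour_bins d w c"
    unfolding colour_bins_def using alg[OF w(2)] by (intro image_cong) auto
  then have "real (card (colour_bins d w c)) \<le> \<beta> * real ?o + K\<^sub>2"
    using colour[OF items_of_in_instances[OF D w(2)] w(1)]
    by (simp add: num_bins_def items_of_colour_items_of)
  also have "\<dots> \<le> \<bar>\<beta>\<bar> + \<bar>K\<^sub>2\<bar>"
    using opt_items_of_colour_le[OF D w(3)] by (cases "?o = 0") (auto simp: le_Suc_eq)
  finally show False using k w(4) by simp
qed

end
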